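(* Let $T$ be an unbiased estimator of $\theta$, let $g_1,g_2,\dots$ be a sequence of zero-estimators, and let $\mathcal{G}=\left\{\sum_{k=1}^m c_k g_k : c_k\in\mathbb{R},\ m\in\mathbb{N}\right\}$. For every $m$ let $\mathbf{g}_m=(g_1,\dots,g_m)^T$ and assume that the covariance matrix $M=\mathrm{Var}[\mathbf{g}_m]$ is positive definite for every $m$. Let $R^*=T+g^*$ with $g^*\in\mathcal{G}$. Then $R^*$ is an optimal oracle estimator (OOE) of $\theta$ with respect to $\mathcal{G}$ if and only if $R^*$ is uncorrelated with every zero-estimator $g\in\mathcal{G}$, i.e., $\mathrm{Cov}_\theta[R^*,g]=0$ for all $g\in\mathcal{G}$ and for all $\theta$.
   Context: The data have a distribution indexed by an unknown parameter $\theta$; $E_\theta,\mathrm{Var}_\theta,\mathrm{Cov}_\theta$ denote expectation, variance and covariance under $\theta$. A zero-estimator is a statistic $g$ with $E_\theta(g)=0$ for all $\theta$. All variances and covariances appearing are assumed to exist and be finite. Definition (OOE). Let $T$ be an unbiased estimator of $\theta$, $g_1,g_2,\dots$ zero-estimators and $\mathcal{G}=\{\sum_{k=1}^m c_kg_k: c_k\in\mathbb{R}, m\in\mathbb{N}\}$. For $g^*\in\mathcal{G}$, $R^*=T+g^*$ is called an optimal oracle estimator (OOE) of $\theta$ with respect to $\mathcal{G}$ if $\mathrm{Var}_\theta[R^*]=\mathrm{Var}_\theta[T+g^*]\le \mathrm{Var}_\theta[T+g]$ for all $g\in\mathcal{G}$ and for all $\theta$. The word "oracle" refers to the fact that the coefficients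 $c_1^*,\dots,c_m^*$ in $g^*=\sum_{k=1}^m c_k^*g_k$ are allowed to be functions of the unknown parameters. *)

theory Defs
  imports "HOL-Probability.Probability" "Jordan_Normal_Form.Matrix"
begin

text \<open>A statistical model: probability measures \<open>P \<theta>\<close>, indexed by the real parameter
  \<open>\<theta> \<in> \<Theta>\<close>, on one common measurable space, that of \<open>S\<close> (only \<open>space S\<close> and \<open>sets S\<close> are used).\<close>

definition statistical_model :: "'a measure \<Rightarrow> real set \<Rightarrow> (real \<Rightarrow> 'a measure) \<Rightarrow> bool" where
  "statistical_model S \<Theta> P \<longleftrightarrow> (\<forall>\<theta>\<in>\<Theta>. prob_space (P \<theta>) \<and> sets (P \<theta>) = sets S)"

definition unbiased_estimator ::
  "'a measure \<Rightarrow> real set \<Rightarrow> (real \<Rightarrow> 'a measure) \<Rightarrow> ('a \<Rightarrow> real) \<Rightarrow> bool" where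
  "unbiased_estimator S \<Theta> P T \<longleftrightarrow>
     T \<in> borel_measurable S \<and>
     (\<forall>\<theta>\<in>\<Theta>. integrable (P \<theta>) T \<and> prob_space.expectation (P \<theta>) T = \<theta>)"

definition zero_estimator ::
  "'a measure \<Rightarrow> real set \<Rightarrow> (real \<Rightarrow> 'a measure) \<Rightarrow> ('a \<Rightarrow> real) \<Rightarrow> bool" where
  "zero_estimator S \<Theta> P g \<longleftrightarrow>
     g \<in> borel_measurable S \<and>
     (\<forall>\<theta>\<in>\<Theta>. integrable (P \<theta>) g \<and> prob_space.expectation (P \<theta>) g = 0)"

text \<open>For a statistic with finite expectation this is finiteness of the variance; it also makes
  the covariance of any two such statistics exist and be finite.\<close>

definition finite_variance :: "real set \<Rightarrow> (real \<Rightarrow> 'a measure) \<Rightarrow> ('a \<Rightarrow> real) \<Rightarrow> bool" where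
  "finite_variance \<Theta> P X \<longleftrightarrow> (\<forall>\<theta>\<in>\<Theta>. integrable (P \<theta>) (\<lambda>x. (X x)\<^sup>2))"

definition covariance :: "'a measure \<Rightarrow> ('a \<Rightarrow> real) \<Rightarrow> ('a \<Rightarrow> real) \<Rightarrow> real" where
  "covariance M X Y =
     prob_space.expectation M
       (\<lambda>x. (X x - prob_space.expectation M X) * (Y x - prob_space.expectation M Y))"

text \<open>Sequences of statistics are indexed from 0, as are matrices: \<open>g 0, \<dots>, g (m - 1)\<close> are the
  statistics usually written \<open>g\<^sub>1, \<dots>, g\<^sub>m\<close>.\<close>

definition covariance_matrix :: "'a measure \<Rightarrow> (nat \<Rightarrow> 'a \<Rightarrow> real) \<Rightarrow> nat \<Rightarrow> real mat" where
  "covariance_matrix M g m = mat m m (\<lambda>(i, j). covariance M (g i) (g j))"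

definition positive_definite :: "real mat \<Rightarrow> bool" where
  "positive_definite A \<longleftrightarrow>
     square_mat A \<and> transpose_mat A = A \<and>
     (\<forall>v \<in> carrier_vec (dim_row A). v \<noteq> 0\<^sub>v (dim_row A) \<longrightarrow> scalar_prod v (A *\<^sub>v v) > 0)"

definition lin_comb :: "(nat \<Rightarrow> 'a \<Rightarrow> real) \<Rightarrow> nat \<Rightarrow> (nat \<Rightarrow> real) \<Rightarrow> 'a \<Rightarrow> real" where
  "lin_comb g m c = (\<lambda>x. \<Sum>k<m. c k * g k x)"

definition lin_combs :: "(nat \<Rightarrow> 'a \<Rightarrow> real) \<Rightarrow> ('a \<Rightarrow> real) set" where
  "lin_combs g = {lin_comb g m c | m c. True}"

text \<open>The oracle elements: linear combinations, of fixed length, whose coefficients may depend on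
  the unknown parameter. They are families of statistics, indexed by \<open>\<theta>\<close>.\<close>

definition oracle_lin_combs ::
  "real set \<Rightarrow> (nat \<Rightarrow> 'a \<Rightarrow> real) \<Rightarrow> (real \<Rightarrow> 'a \<Rightarrow> real) set" where
  "oracle_lin_combs \<Theta> g = {h. \<exists>m c. \<forall>\<theta>\<in>\<Theta>. h \<theta> = lin_comb g m (c \<theta>)}"

text \<open>The competitors are combinations with real coefficients. Since the inequality is required for
  each \<open>\<theta>\<close> separately, competitors with \<open>\<theta>\<close>-dependent coefficients are covered as well.\<close>

definition optimal_oracle_estimator ::
  "real set \<Rightarrow> (real \<Rightarrow> 'a measure) \<Rightarrow> ('a \<Rightarrow> real) \<Rightarrow> (nat \<Rightarrow> 'a \<Rightarrow> real) \<Rightarrow>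
   (real \<Rightarrow> 'a \<Rightarrow> real) \<Rightarrow> bool" where
  "optimal_oracle_estimator \<Theta> P T g R \<longleftrightarrow>
     (\<exists>gs \<in> oracle_lin_combs \<Theta> g. \<forall>\<theta>\<in>\<Theta>. R \<theta> = (\<lambda>x. T x + gs \<theta> x)) \<and>
     (\<forall>h \<in> lin_combs g. \<forall>\<theta>\<in>\<Theta>.
        prob_space.variance (P \<theta>) (R \<theta>) \<le> prob_space.variance (P \<theta>) (\<lambda>x. T x + h x))"

end

theory Submission
  imports Defs
begin

text \<open>
  Fix a parameter value. The statistics of finite variance form a vector space on which covariance
  is a positive semidefinite symmetric bilinear form, with the variance as its quadratic form, and
  the linear combinations of the \<open>g k\<close> form a subspace \<open>V\<close>. As the oracle
  element lies in \<open>V\<close>, the competitors \<open>T + h\<close> make up the coset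
  \<open>R + V\<close>: optimality says that \<open>R\<close> has the least variance in its coset. For a
  form of this kind that is orthogonality to \<open>V\<close>
  (\<open>variance_minimal_iff_uncorrelated\<close>): along a line \<open>R + t h\<close> the variance is the
  parabola \<open>Var R + 2 t Cov (R, h) + t\<^sup>2 Var h\<close>, which has its minimum at \<open>t = 0\<close> exactly if
  its linear coefficient vanishes.

  The coefficients of the oracle element may vary with the parameter, but the argument looks at
  one parameter value at a time, so it is enough that each single value of that family lies in
  \<open>V\<close>.
\<close>

section \<open>Square-integrable statistics\<close>

definition square_integrable :: "'a measure \<Rightarrow> ('a \<Rightarrow> real) \<Rightarrow> bool" where
  "square_integrable M X \<longleftrightarrow> X \<in> borel_measurable M \<and> integrable M (\<lambda>x. (X x)\<^sup>2)"

lemma square_integrable_mult_integrable: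
  assumes "square_integrable M X" "square_integrable M Y"
  shows "integrable M (\<lambda>x. X x * Y x)"
proof (rule Bochner_Integration.integrable_bound)
  show "integrable M (\<lambda>x. (X x)\<^sup>2 + (Y x)\<^sup>2)"
    using assms by (auto simp: square_integrable_def)
  show "(\<lambda>x. X x * Y x) \<in> borel_measurable M"
    using assms by (auto simp: square_integrable_def)
  have "\<bar>a * b\<bar> \<le> a\<^sup>2 + b\<^sup>2" for a b :: real
  proof -
    have "2 * (\<bar>a\<bar> * \<bar>b\<bar>) \<le> a\<^sup>2 + b\<^sup>2"
      using sum_squares_bound[of "\<bar>a\<bar>" "\<bar>b\<bar>"] by simp
    moreover have "0 \<le> \<bar>a\<bar> * \<bar>b\<bar>" by simp
    ultimately show ?thesis unfolding abs_mult by linarith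
  qed
  then show "AE x in M. norm (X x * Y x) \<le> norm ((X x)\<^sup>2 + (Y x)\<^sup>2)"
    by simp
qed

lemma square_integrable_add:
  assumes "square_integrable M X" "square_integrable M Y"
  shows "square_integrable M (\<lambda>x. X x + Y x)"
proof -
  have "integrable M (\<lambda>x. (X x)\<^sup>2 + (Y x)\<^sup>2 + 2 * (X x * Y x))"
    using assms square_integrable_mult_integrable[OF assms]
    by (auto simp: square_integrable_def)
  then show ?thesis
    using assms by (auto simp: square_integrable_def power2_sum mult.assoc)
qed

lemma square_integrable_scale:
  "square_integrable M X \<Longrightarrow> square_integrable M (\<lambda>x. c * X x)"
  by (auto simp: square_integrable_def power_mult_distrib)

lemma square_integrable_sum:
  "finite K \<Longrightarrow> (\<And>k. k \<in> K \<Longrightarrow> square_integrable M (f k)) \<Longrightarrow>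
    square_integrable M (\<lambda>x. \<Sum>k\<in>K. f k x)"
proof (induction K rule: finite_induct)
  case empty
  then show ?case by (simp add: square_integrable_def)
next
  case (insert k K)
  then show ?case by (simp add: square_integrable_add)
qed

lemma (in prob_space) square_integrable_integrable:
  "square_integrable M X \<Longrightarrow> integrable M X"
  unfolding square_integrable_def using square_integrable_imp_integrable by blast

lemma (in prob_space) square_integrable_centered:
  assumes "square_integrable M X"
  shows "square_integrable M (\<lambda>x. X x - expectation X)"
  using square_integrable_add[OF assms, of "\<lambda>_. - expectation X"]
  by (simp add: square_integrable_def)

section \<open>Variance as the quadratic form of the covariance\<close>

context prob_space
begin

lemma variance_scale:
  fixes X :: "'a \<Rightarrow> real"
  shows "variance (\<lambda>x. c * X x) = c\<^sup>2 * variance X"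
proof -
  have "(c * X x - c * expectation X)\<^sup>2 = c\<^sup>2 * (X x - expectation X)\<^sup>2" for x
    by (simp add: power2_eq_square algebra_simps)
  then show ?thesis by simp
qed

lemma covariance_scale_right: "covariance M X (\<lambda>x. c * Y x) = c * covariance M X Y"
proof -
  have "(X x - expectation X) * (c * Y x - c * expectation Y)
      = c * ((X x - expectation X) * (Y x - expectation Y))" for x
    by (simp only: right_diff_distrib mult.left_commute)
  then show ?thesis
    unfolding covariance_def integral_mult_right_zero by (simp only: integral_mult_right_zero)
qed

lemma variance_add:
  assumes X: "square_integrable M X" and Y: "square_integrable M Y"
  shows "variance (\<lambda>x. X x + Y x) = variance X + 2 * covariance M X Y + variance Y"
proof -
  let ?X = "\<lambda>x. X x - expectation X" and ?Y = "\<lambda>x. Y x - expectation Y"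
  note centered = square_integrable_centered[OF X] square_integrable_centered[OF Y]
  have "(X x + Y x - expectation (\<lambda>x. X x + Y x))\<^sup>2
      = (?X x)\<^sup>2 + 2 * (?X x * ?Y x) + (?Y x)\<^sup>2" for x
    using X Y by (simp add: square_integrable_integrable power2_eq_square algebra_simps)
  then have "variance (\<lambda>x. X x + Y x)
      = expectation (\<lambda>x. (?X x)\<^sup>2 + 2 * (?X x * ?Y x) + (?Y x)\<^sup>2)"
    by simp
  also have "\<dots> = variance X + 2 * covariance M X Y + variance Y"
    using centered square_integrable_mult_integrable[OF centered]
    by (simp add: square_integrable_def covariance_def)
  finally show ?thesis .
qed

end

section \<open>Least variance means uncorrelated\<close>

text \<open>The witness \<open>t\<close> is the vertex \<open>- b / a\<close> of the parabola; if \<open>a = 0\<close>, the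
  parabola degenerates to a line, and \<open>t = - b\<close> goes downhill.\<close>

lemma linear_coefficient_zero:
  fixes a b :: real
  assumes "a \<ge> 0" and nonneg: "\<And>t. 0 \<le> 2 * t * b + t\<^sup>2 * a"
  shows "b = 0"
proof (cases "a = 0")
  case True
  then show ?thesis using nonneg[of "- b"] by (auto simp: mult_le_0_iff)
next
  case False
  with \<open>a \<ge> 0\<close> have "a > 0" by simp
  have "2 * (- b / a) * b + (- b / a)\<^sup>2 * a = - (b\<^sup>2 / a)"
    using \<open>a > 0\<close> by (simp add: power2_eq_square field_simps)
  then have "b\<^sup>2 / a \<le> 0" using nonneg[of "- b / a"] by simp
  then show ?thesis using \<open>a > 0\<close> by (simp add: divide_le_0_iff)
qed

text \<open>Closure of \<open>V\<close> under scaling provides, for each direction, a whole line of competitors along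
  which \<open>X\<close> is compared; conversely, if \<open>X\<close> is uncorrelated with \<open>h\<close>, then \<open>X + h\<close> exceeds \<open>X\<close> in
  variance by \<open>Var h\<close>.\<close>

lemma (in prob_space) variance_minimal_iff_uncorrelated:
  assumes X: "square_integrable M X"
    and V: "\<And>h. h \<in> V \<Longrightarrow> square_integrable M h"
    and scale: "\<And>h c. h \<in> V \<Longrightarrow> (\<lambda>x. c * h x) \<in> V"
  shows "(\<forall>h\<in>V. variance X \<le> variance (\<lambda>x. X x + h x)) \<longleftrightarrow> (\<forall>h\<in>V. covariance M X h = 0)"
proof (intro iffI ballI)
  fix h assume minimal: "\<forall>h\<in>V. variance X \<le> variance (\<lambda>x. X x + h x)" and "h \<in> V"
  have "0 \<le> 2 * t * covariance M X h + t\<^sup>2 * variance h" for t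
  proof -
    have th: "(\<lambda>x. t * h x) \<in> V" using scale \<open>h \<in> V\<close> .
    have "variance X \<le> variance (\<lambda>x. X x + t * h x)" using bspec[OF minimal th] .
    also have "\<dots> = variance X + 2 * (t * covariance M X h) + t\<^sup>2 * variance h"
      using variance_add[OF X V[OF th]] unfolding covariance_scale_right variance_scale .
    finally show ?thesis by simp
  qed
  then show "covariance M X h = 0"
    by (rule linear_coefficient_zero[rotated]) simp
next
  fix h assume "\<forall>h\<in>V. covariance M X h = 0" and "h \<in> V"
  then show "variance X \<le> variance (\<lambda>x. X x + h x)"
    using variance_add[OF X V] by simp
qed

section \<open>Linear combinations of a sequence of statistics\<close>

lemma lin_combs_scale:
  assumes "h \<in> lin_combs g"
  shows "(\<lambda>x. a * h x) \<in> lin_combs g"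
proof -
  obtain m c where "h = lin_comb g m c" using assms by (auto simp: lin_combs_def)
  then have "(\<lambda>x. a * h x) = lin_comb g m (\<lambda>k. a * c k)"
    by (simp add: lin_comb_def sum_distrib_left mult.assoc)
  then show ?thesis by (auto simp: lin_combs_def)
qed

text \<open>Padding with zero coefficients allows two combinations to be brought to a common length.\<close>

lemma lin_comb_pad:
  assumes "m \<le> n"
  shows "lin_comb g m c = lin_comb g n (\<lambda>k. if k < m then c k else 0)"
proof
  fix x
  have "(\<Sum>k<n. (if k < m then c k else 0) * g k x) = (\<Sum>k\<in>{..<m}. c k * g k x)"
    using assms by (intro sum.mono_neutral_cong_right) auto
  then show "lin_comb g m c x = lin_comb g n (\<lambda>k. if k < m then c k else 0) x"
    by (simp add: lin_comb_def)
qed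

lemma lin_combs_add:
  assumes "h \<in> lin_combs g" "h' \<in> lin_combs g"
  shows "(\<lambda>x. h x + h' x) \<in> lin_combs g"
proof -
  obtain m c m' c' where "h = lin_comb g m c" "h' = lin_comb g m' c'"
    using assms by (auto simp: lin_combs_def)
  then obtain d d' where "h = lin_comb g (max m m') d" "h' = lin_comb g (max m m') d'"
    using lin_comb_pad max.cobounded1 max.cobounded2 by metis
  then have "(\<lambda>x. h x + h' x) = lin_comb g (max m m') (\<lambda>k. d k + d' k)"
    by (simp add: lin_comb_def sum.distrib distrib_right)
  then show ?thesis by (auto simp: lin_combs_def)
qed

lemma lin_combs_diff:
  assumes "h \<in> lin_combs g" "h' \<in> lin_combs g"
  shows "(\<lambda>x. h x - h' x) \<in> lin_combs g"
  using lin_combs_add[OF assms(1) lin_combs_scale[OF assms(2), of "- 1"]] by simp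

lemma lin_combs_square_integrable:
  assumes "\<And>k. square_integrable M (g k)" "h \<in> lin_combs g"
  shows "square_integrable M h"
  using assms
  by (auto simp: lin_combs_def lin_comb_def intro!: square_integrable_sum square_integrable_scale)

lemma oracle_lin_combs_at:
  "gs \<in> oracle_lin_combs \<Theta> g \<Longrightarrow> \<theta> \<in> \<Theta> \<Longrightarrow> gs \<theta> \<in> lin_combs g"
  by (auto simp: oracle_lin_combs_def lin_combs_def)

section \<open>Optimal oracle estimators\<close>

theorem theorem2p1:
  fixes S :: "'a measure" and \<Theta> :: "real set" and P :: "real \<Rightarrow> 'a measure"
    and T :: "'a \<Rightarrow> real" and g :: "nat \<Rightarrow> 'a \<Rightarrow> real"
    and gs R :: "real \<Rightarrow> 'a \<Rightarrow> real"
  assumes "statistical_model S \<Theta> P"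
    and "unbiased_estimator S \<Theta> P T"
    and "\<And>k. zero_estimator S \<Theta> P (g k)"
    and "finite_variance \<Theta> P T"
    and "\<And>k. finite_variance \<Theta> P (g k)"
    and "\<And>\<theta> m. \<theta> \<in> \<Theta> \<Longrightarrow> positive_definite (covariance_matrix (P \<theta>) g m)"
    and "gs \<in> oracle_lin_combs \<Theta> g"
    and "\<And>\<theta>. \<theta> \<in> \<Theta> \<Longrightarrow> R \<theta> = (\<lambda>x. T x + gs \<theta> x)"
  shows "optimal_oracle_estimator \<Theta> P T g R \<longleftrightarrow>
    (\<forall>h \<in> lin_combs g. \<forall>\<theta>\<in>\<Theta>. covariance (P \<theta>) (R \<theta>) h = 0)"
proof -
  let ?V = "lin_combs g"
  have at_parameter:
    "(\<forall>h\<in>?V. prob_space.variance (P \<theta>) (R \<theta>) \<le> prob_space.variance (P \<theta>) (\<lambda>x. T x + h x))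
      \<longleftrightarrow> (\<forall>h\<in>?V. covariance (P \<theta>) (R \<theta>) h = 0)" if \<theta>: "\<theta> \<in> \<Theta>" for \<theta>
  proof -
    interpret prob_space "P \<theta>"
      using assms(1) \<theta> by (simp add: statistical_model_def)
    have "sets (P \<theta>) = sets S" using assms(1) \<theta> by (simp add: statistical_model_def)
    note measurable = measurable_cong_sets[OF this refl]
    have T: "square_integrable (P \<theta>) T"
      using assms(2,4) \<theta>
      by (simp add: square_integrable_def unbiased_estimator_def finite_variance_def measurable)
    have g: "square_integrable (P \<theta>) (g k)" for k
      using assms(3,5)[of k] \<theta>
      by (simp add: square_integrable_def zero_estimator_def finite_variance_def measurable)
    have V: "square_integrable (P \<theta>) h" if "h \<in> ?V" for h
      using lin_combs_square_integrable[OF g that] .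
    note gs = oracle_lin_combs_at[OF assms(7) \<theta>]
    have R: "square_integrable (P \<theta>) (R \<theta>)"
      unfolding assms(8)[OF \<theta>] by (rule square_integrable_add[OF T V[OF gs]])
    \<comment> \<open>The cosets \<open>T + V\<close> and \<open>R + V\<close> coincide, since \<open>R\<close> and \<open>T\<close> differ by an element of \<open>V\<close>.\<close>
    have "(\<lambda>h x. T x + h x) ` ?V = (\<lambda>h x. R \<theta> x + h x) ` ?V"
    proof (intro equalityI image_subsetI)
      fix h assume h: "h \<in> ?V"
      have "(\<lambda>x. T x + h x) = (\<lambda>x. R \<theta> x + (h x - gs \<theta> x))"
        by (simp add: assms(8)[OF \<theta>])
      then show "(\<lambda>x. T x + h x) \<in> (\<lambda>h x. R \<theta> x + h x) ` ?V"
        using lin_combs_diff[OF h gs] by (auto intro: image_eqI)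
      have "(\<lambda>x. R \<theta> x + h x) = (\<lambda>x. T x + (gs \<theta> x + h x))"
        by (simp add: assms(8)[OF \<theta>] add.assoc)
      then show "(\<lambda>x. R \<theta> x + h x) \<in> (\<lambda>h x. T x + h x) ` ?V"
        using lin_combs_add[OF gs h] by (auto intro: image_eqI)
    qed
    then have "(\<forall>Y \<in> (\<lambda>h x. T x + h x) ` ?V. variance (R \<theta>) \<le> variance Y)
        \<longleftrightarrow> (\<forall>Y \<in> (\<lambda>h x. R \<theta> x + h x) ` ?V. variance (R \<theta>) \<le> variance Y)"
      by (rule arg_cong)
    then have "(\<forall>h\<in>?V. variance (R \<theta>) \<le> variance (\<lambda>x. T x + h x))
        \<longleftrightarrow> (\<forall>h\<in>?V. variance (R \<theta>) \<le> variance (\<lambda>x. R \<theta> x + h x))"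
      by (simp only: Set.ball_simps)
    also have "\<dots> \<longleftrightarrow> (\<forall>h\<in>?V. covariance (P \<theta>) (R \<theta>) h = 0)"
      using variance_minimal_iff_uncorrelated[OF R V lin_combs_scale] .
    finally show ?thesis .
  qed
  have "\<exists>gs \<in> oracle_lin_combs \<Theta> g. \<forall>\<theta>\<in>\<Theta>. R \<theta> = (\<lambda>x. T x + gs \<theta> x)"
    using assms(7,8) by blast
  then show ?thesis
    unfolding optimal_oracle_estimator_def using at_parameter by blast
qed

end
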